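(* Let $m\ge 3$ and let $W_m$ be the wheel graph on $m+1$ vertices. If $m=k^2+c$ for some integer $k>0$ and some integer $c$ with $0\le c\le 2k$, then $$\operatorname{sn}(W_m)=\lceil\sqrt{m}\,\rceil+1=\begin{cases}\lfloor\sqrt{m}\rfloor+1 & \text{if } c=0,\\ \lfloor\sqrt{m}\rfloor+2 & \text{otherwise,}\end{cases}$$ where $\operatorname{sn}$ denotes the scramble number.
   Context: The fan graph $F_m$ is the graph with $m+1$ vertices $v_0,\dots,v_m$, with an edge between $v_0$ and $v_i$ for all $i\ge 1$, and an edge between $v_i$ and $v_j$ whenever $i,j\ge 1$ and $|i-j|=1$. The wheel graph $W_m$ is $F_m$ with the addition of an edge between $v_1$ and $v_m$. All graphs are finite and simple. Scramble number. A scramble $\mathcal{S}=\{\mathcal{E}_1,\dots,\mathcal{E}_r\}$ on a graph $G$ is a collection of (nonempty) connected subgraphs of $G$, called eggs. A hitting set for $\mathcal{S}$ is a set of vertices of $G$ having nonempty intersection with each egg; the hitting size $h(\mathcal{S})$ is the minimum size of a hitting set. An egg-cut for $\mathcal{S}$ is a set of edges $C(A,B)=\{e\in E(G) : e=\{a,b\},\ a\in A,\ b\in B\}$, where $V(G)=A\sqcup B$ and at least one egg has all its vertices in $A$ and at least one egg has all its vertices in $B$. The egg-cut size $e(\mathcal{S})$ is the minimum number of edges in an egg-cut, with $e(\mathcal{S})=\infty$ if there is no egg-cut. The order of $\mathcal{S}$ is $\|\mathcal{S}\|=\min\{h(\mathcal{S}),e(\mathcal{S})\}$, and $\operatorname{sn}(G)$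 is the maximum of $\|\mathcal{S}\|$ over all scrambles $\mathcal{S}$ on $G$. *)

theory Defs
  imports Complex_Main "HOL-Library.Extended_Nat"
begin

datatype 'a graph = Graph (verts: "'a set") (edges: "'a set set")

definition simple_graph :: "'a graph \<Rightarrow> bool" where
  "simple_graph G \<longleftrightarrow> finite (verts G) \<and> (\<forall>e\<in>edges G. e \<subseteq> verts G \<and> card e = 2)"

definition subgraph :: "'a graph \<Rightarrow> 'a graph \<Rightarrow> bool" where
  "subgraph H G \<longleftrightarrow> simple_graph H \<and> verts H \<subseteq> verts G \<and> edges H \<subseteq> edges G"

definition adj :: "'a graph \<Rightarrow> ('a \<times> 'a) set" where
  "adj G = {(u, v). {u, v} \<in> edges G}"

definition connected_graph :: "'a graph \<Rightarrow> bool" where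
  "connected_graph G \<longleftrightarrow> (\<forall>u\<in>verts G. \<forall>v\<in>verts G. (u, v) \<in> (adj G)\<^sup>*)"

definition scramble :: "'a graph \<Rightarrow> 'a graph set \<Rightarrow> bool" where
  "scramble G S \<longleftrightarrow> (\<forall>H\<in>S. subgraph H G \<and> verts H \<noteq> {} \<and> connected_graph H)"

definition hitting_set :: "'a graph \<Rightarrow> 'a graph set \<Rightarrow> 'a set \<Rightarrow> bool" where
  "hitting_set G S X \<longleftrightarrow> X \<subseteq> verts G \<and> (\<forall>H\<in>S. X \<inter> verts H \<noteq> {})"

definition hitting_size :: "'a graph \<Rightarrow> 'a graph set \<Rightarrow> enat" where
  "hitting_size G S = Inf {enat (card X) | X. hitting_set G S X}"

definition cut_edges :: "'a graph \<Rightarrow> 'a set \<Rightarrow> 'a set \<Rightarrow> 'a set set" where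
  "cut_edges G A B = {e \<in> edges G. \<exists>a\<in>A. \<exists>b\<in>B. e = {a, b}}"

definition egg_cut :: "'a graph \<Rightarrow> 'a graph set \<Rightarrow> 'a set set \<Rightarrow> bool" where
  "egg_cut G S C \<longleftrightarrow> (\<exists>A B. A \<union> B = verts G \<and> A \<inter> B = {} \<and>
      (\<exists>H\<in>S. verts H \<subseteq> A) \<and> (\<exists>H\<in>S. verts H \<subseteq> B) \<and> C = cut_edges G A B)"

(* In enat the infimum of a nonempty set is its minimum and Inf {} = \<infinity>,
   which is the convention when there is no egg-cut. *)
definition egg_cut_size :: "'a graph \<Rightarrow> 'a graph set \<Rightarrow> enat" where
  "egg_cut_size G S = Inf {enat (card C) | C. egg_cut G S C}"

definition scramble_order :: "'a graph \<Rightarrow> 'a graph set \<Rightarrow> enat" where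
  "scramble_order G S = min (hitting_size G S) (egg_cut_size G S)"

(* A finite graph has only finitely many subgraphs, hence only finitely many scrambles,
   so Max is applied to a finite set; the empty scramble is allowed and has order 0. *)
definition scramble_number :: "'a graph \<Rightarrow> enat" where
  "scramble_number G = Max {scramble_order G S | S. scramble G S}"

definition fan :: "nat \<Rightarrow> nat graph" where
  "fan m = Graph {0..m}
     ({{0, i} | i. i \<in> {1..m}} \<union>
      {{i, j} | i j. i \<in> {1..m} \<and> j \<in> {1..m} \<and> \<bar>int i - int j\<bar> = 1})"

definition wheel :: "nat \<Rightarrow> nat graph" where
  "wheel m = Graph (verts (fan m)) (edges (fan m) \<union> {{1, m}})"

lemma simple_graph_wheel: "m \<ge> 3 \<Longrightarrow> simple_graph (wheel m)"
  by (auto simp: simple_graph_def wheel_def fan_def card_insert_if)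

lemma finite_scrambles:
  assumes "simple_graph G"
  shows "finite {S. scramble G S}"
proof -
  have "finite (verts G)" "finite (edges G)"
    using assms finite_subset[of "edges G" "Pow (verts G)"]
    by (auto simp: simple_graph_def)
  then have "finite ((\<lambda>(V, E). Graph V E) ` (Pow (verts G) \<times> Pow (edges G)))"
    by simp
  moreover have "{H. subgraph H G} \<subseteq> (\<lambda>(V, E). Graph V E) ` (Pow (verts G) \<times> Pow (edges G))"
  proof
    fix H assume "H \<in> {H. subgraph H G}"
    then show "H \<in> (\<lambda>(V, E). Graph V E) ` (Pow (verts G) \<times> Pow (edges G))"
      by (intro image_eqI[of _ _ "(verts H, edges H)"]) (auto simp: subgraph_def)
  qed
  ultimately have "finite {H. subgraph H G}"
    by (rule finite_subset[rotated])
  then have "finite (Pow {H. subgraph H G})"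
    by simp
  moreover have "{S. scramble G S} \<subseteq> Pow {H. subgraph H G}"
    by (auto simp: scramble_def)
  ultimately show ?thesis
    by (rule finite_subset[rotated])
qed

end

theory Submission imports Defs begin

text \<open>
  Write \<open>l = \<lceil>sqrt m\<rceil> - 1\<close>, so that \<open>l\<^sup>2 < m \<le> (l + 1)\<^sup>2\<close>; the claim is
  that the scramble number of the wheel is \<open>l + 2\<close>.  The two inequalities reflect one trade-off:
  long arcs of the rim are easy to hit, short arcs are cheap to cut off.

  For the lower bound, take as eggs the hub alone and all \<open>m\<close> cyclic arcs of \<open>l\<close> rim vertices.
  A hitting set contains the hub, and each of its rim vertices lies on at most \<open>l\<close> of the \<open>m > l\<^sup>2\<close>
  arcs, so it has more than \<open>l\<close> rim vertices (\<open>hitting_set_arc_scramble\<close>).  The side of an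
  egg-cut without the hub contains an arc; each of its vertices contributes a spoke, and unless it
  is the whole rim there are two more cut edges where it begins and ends (\<open>egg_cut_arc_scramble\<close>).

  For the upper bound, take an arbitrary scramble.  An egg that avoids the hub is a connected piece
  of a cycle, hence an arc or the whole rim (\<open>hub_free_egg_cases\<close>).
  If all these eggs have more than \<open>l\<close> vertices, then the hub together with every
  \<open>(l + 1)\<close>-st rim vertex is a hitting set with at most \<open>1 + (l + 1)\<close> elements, since
  \<open>m \<le> (l + 1)\<^sup>2\<close>.  Otherwise some arc of at most \<open>l\<close> vertices is an egg.  Either it meets all
  eggs and so is itself a small hitting set, or some egg is disjoint from it and it can be cut off by
  its at most \<open>l\<close> spokes and the two rim edges at its ends.
\<close>

section \<open>The rim as a cycle of arcs\<close>

text \<open>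
  Indexing the rim by all natural numbers modulo \<open>m\<close> makes the closing edge between \<open>1\<close> and
  \<open>m\<close> an instance of the same pattern as the other rim edges.
\<close>

definition rim :: "nat \<Rightarrow> nat \<Rightarrow> nat" where
  "rim m j = Suc (j mod m)"

definition arc :: "nat \<Rightarrow> nat \<Rightarrow> nat \<Rightarrow> nat set" where
  "arc m t l = (\<lambda>i. rim m (t + i)) ` {..<l}"

lemma rim_eq_iff: "rim m i = rim m j \<longleftrightarrow> i mod m = j mod m"
  by (simp add: rim_def)

lemma rim_nonzero [simp]: "rim m j \<noteq> 0" "0 \<noteq> rim m j"
  by (simp_all add: rim_def)

lemma rim_Suc_eq_iff: "rim m (Suc i) = rim m (Suc j) \<longleftrightarrow> rim m i = rim m j"
  by (auto simp: rim_def mod_Suc split: if_splits)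

lemma rim_add_mod: "rim m (i mod m + j) = rim m (i + j)"
  by (simp add: rim_eq_iff mod_simps)

lemma range_rim:
  assumes "m > 0"
  shows "range (rim m) = {1..m}"
proof
  show "range (rim m) \<subseteq> {1..m}"
    using assms by (auto simp: rim_def Suc_le_eq)
  show "{1..m} \<subseteq> range (rim m)"
  proof
    fix x assume "x \<in> {1..m}"
    then have "x = rim m (x - 1)" by (auto simp: rim_def)
    then show "x \<in> range (rim m)" by blast
  qed
qed

lemma rim_in: "m > 0 \<Longrightarrow> rim m j \<in> {1..m}"
  using range_rim by blast

lemma rim_cases:
  assumes "x \<in> {1..m}"
  obtains j where "x = rim m j" "j < m"
  using assms that[of "x - 1"] by (auto simp: rim_def)

lemma arc_subset_rim: "m > 0 \<Longrightarrow> arc m t l \<subseteq> {1..m}"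
  using rim_in unfolding arc_def by blast

lemma arc_memI: "i < l \<Longrightarrow> rim m (t + i) \<in> arc m t l"
  by (simp add: arc_def)

lemma finite_arc: "finite (arc m t l)"
  by (simp add: arc_def)

lemma card_arc:
  assumes "l \<le> m"
  shows "card (arc m t l) = l"
proof -
  have "inj_on (\<lambda>i. rim m (t + i)) {..<l}"
  proof (rule linorder_inj_onI)
    fix i j assume ij: "i < j" "i \<in> {..<l}" "j \<in> {..<l}"
    show "rim m (t + i) \<noteq> rim m (t + j)"
    proof
      assume "rim m (t + i) = rim m (t + j)"
      then have "m dvd (t + j) - (t + i)"
        using ij by (metis rim_eq_iff mod_eq_dvd_iff_nat add_le_mono order_refl less_imp_le)
      then show False
        using ij assms by (auto dest: dvd_imp_le)
    qed
  qed auto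
  then show ?thesis by (simp add: arc_def card_image)
qed

lemma verts_wheel: "verts (wheel m) = {0..m}"
  by (simp add: wheel_def fan_def)

lemma edges_wheel:
  assumes "m \<ge> 3"
  shows "edges (wheel m) = range (\<lambda>j. {0, rim m j}) \<union> range (\<lambda>j. {rim m j, rim m (Suc j)})"
    (is "_ = ?spokes \<union> ?rim")
proof
  have step: "{i, Suc i} \<in> ?rim" if "1 \<le> i" "Suc i \<le> m" for i
  proof -
    have "i = rim m (i - 1)" "Suc i = rim m (Suc (i - 1))"
      using that by (auto simp: rim_def)
    then show ?thesis by (metis (no_types, lifting) rangeI)
  qed
  have "{1, m} = {rim m (m - 1), rim m (Suc (m - 1))}"
    using assms by (auto simp: rim_def)
  then have close: "{1, m} \<in> ?rim" by blast
  have "{0, i} \<in> ?spokes" if "i \<in> {1..m}" for i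
    using that by (elim rim_cases) auto
  moreover have "{i, j} \<in> ?rim" if "i \<in> {1..m}" "j \<in> {1..m}" "\<bar>int i - int j\<bar> = 1" for i j
  proof -
    have "j = Suc i \<or> i = Suc j" using that(3) by linarith
    then show ?thesis
      using step[of i] step[of j] that by (auto simp: insert_commute)
  qed
  ultimately show "edges (wheel m) \<subseteq> ?spokes \<union> ?rim"
    using close unfolding wheel_def fan_def graph.sel by blast
next
  have "{0, rim m j} \<in> edges (wheel m)" for j
    using rim_in[of m j] assms unfolding wheel_def fan_def graph.sel by auto
  moreover have "{rim m j, rim m (Suc j)} \<in> edges (wheel m)" for j
  proof (cases "Suc (j mod m) = m")
    case True
    then have "{rim m j, rim m (Suc j)} = {1, m}"
      by (auto simp: rim_def mod_Suc)
    then show ?thesis by (simp add: wheel_def)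
  next
    case False
    then have "\<bar>int (rim m j) - int (rim m (Suc j))\<bar> = 1"
      by (simp add: rim_def mod_Suc)
    moreover have "rim m j \<in> {1..m}" "rim m (Suc j) \<in> {1..m}"
      using assms rim_in by auto
    ultimately show ?thesis unfolding wheel_def fan_def graph.sel by blast
  qed
  ultimately show "?spokes \<union> ?rim \<subseteq> edges (wheel m)" by blast
qed

lemma rim_neighbour_cases:
  assumes "m \<ge> 3" "{rim m i, v} \<in> edges (wheel m)"
  obtains "v = 0" | "v = rim m (Suc i)" | j where "v = rim m j" "rim m i = rim m (Suc j)"
proof -
  consider j where "{rim m i, v} = {0, rim m j}"
    | j where "{rim m i, v} = {rim m j, rim m (Suc j)}"
    using assms by (auto simp: edges_wheel)
  then show thesis
  proof cases
    case 1
    then show thesis using that(1) by (auto simp: doubleton_eq_iff)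
  next
    case 2
    then consider "rim m i = rim m j" "v = rim m (Suc j)" | "rim m i = rim m (Suc j)" "v = rim m j"
      by (auto simp: doubleton_eq_iff)
    then show thesis
      by cases (use that(2,3) rim_Suc_eq_iff in metis)+
  qed
qed

text \<open>
  Going once around a cycle from a vertex with the property, the property must be lost somewhere
  unless all vertices have it.
\<close>

lemma rim_property_lost:
  assumes "m > 0" "x \<in> {1..m}" "P x" "y \<in> {1..m}" "\<not> P y"
  obtains j where "P (rim m j)" "\<not> P (rim m (Suc j))"
proof -
  from assms obtain a b where ab: "x = rim m a" "a < m" "y = rim m b" "b < m"
    by (metis rim_cases)
  have "\<not> P (rim m (a + (b + m - a)))"
    using assms ab by (simp add: rim_def)
  moreover have "P (rim m (a + i))" if "\<And>j. P (rim m j) \<Longrightarrow> P (rim m (Suc j))" for i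
    by (induction i) (use assms ab that in auto)
  ultimately show thesis using that by blast
qed

section \<open>The scramble of short arcs\<close>

definition induced_subgraph :: "'a graph \<Rightarrow> 'a set \<Rightarrow> 'a graph" where
  "induced_subgraph G A = Graph A {e \<in> edges G. e \<subseteq> A}"

definition arc_scramble :: "nat \<Rightarrow> nat \<Rightarrow> nat graph set" where
  "arc_scramble m l =
    insert (induced_subgraph (wheel m) {0}) (range (\<lambda>t. induced_subgraph (wheel m) (arc m t l)))"

lemma verts_induced_subgraph [simp]: "verts (induced_subgraph G A) = A"
  by (simp add: induced_subgraph_def)

lemma subgraph_induced_subgraph:
  assumes "simple_graph G" "A \<subseteq> verts G"
  shows "subgraph (induced_subgraph G A) G"
  using assms finite_subset
  by (auto simp: subgraph_def simple_graph_def induced_subgraph_def)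

lemma adj_sym: "sym (adj G)"
  by (auto simp: sym_def adj_def insert_commute)

lemma connected_arc:
  assumes "m \<ge> 3"
  shows "connected_graph (induced_subgraph (wheel m) (arc m t l))"
proof -
  let ?R = "(adj (induced_subgraph (wheel m) (arc m t l)))\<^sup>*"
  have from_start: "(rim m t, rim m (t + i)) \<in> ?R" if "i < l" for i
    using that
  proof (induction i)
    case (Suc i)
    have "rim m (t + i) \<in> arc m t l" "rim m (t + Suc i) \<in> arc m t l"
      using Suc.prems arc_memI[of i l] arc_memI[of "Suc i" l] by simp_all
    then have "(rim m (t + i), rim m (t + Suc i)) \<in> adj (induced_subgraph (wheel m) (arc m t l))"
      using assms by (auto simp: adj_def induced_subgraph_def edges_wheel)
    with Suc show ?case by (meson Suc_lessD rtrancl.rtrancl_into_rtrancl)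
  qed simp
  have "sym ?R" by (intro sym_rtrancl adj_sym)
  have "(u, v) \<in> ?R" if "u \<in> arc m t l" "v \<in> arc m t l" for u v
  proof -
    from that have "(rim m t, u) \<in> ?R" "(rim m t, v) \<in> ?R"
      using from_start by (auto simp: arc_def)
    with \<open>sym ?R\<close> show ?thesis by (meson rtrancl_trans symD)
  qed
  then show ?thesis by (simp add: connected_graph_def)
qed

lemma scramble_arc_scramble:
  assumes "m \<ge> 3" "l > 0"
  shows "scramble (wheel m) (arc_scramble m l)"
proof -
  have "subgraph (induced_subgraph (wheel m) (arc m t l)) (wheel m)" for t
    using assms arc_subset_rim[of m t l]
    by (intro subgraph_induced_subgraph simple_graph_wheel) (auto simp: verts_wheel)
  moreover have "subgraph (induced_subgraph (wheel m) {0}) (wheel m)"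
    using assms by (intro subgraph_induced_subgraph simple_graph_wheel) (auto simp: verts_wheel)
  moreover have "connected_graph (induced_subgraph (wheel m) {0})"
    by (simp add: connected_graph_def)
  moreover have "arc m t l \<noteq> {}" for t
    using assms by (auto simp: arc_def)
  ultimately show ?thesis
    using connected_arc[OF assms(1)] by (auto simp: scramble_def arc_scramble_def)
qed

text \<open>
  Double counting: the \<open>m\<close> arcs are told apart by their starting positions, and a given rim vertex
  lies on at most one arc in which it has the offset \<open>i\<close>, for each \<open>i < l\<close>.
\<close>

lemma hitting_set_arc_scramble:
  assumes "m > 0" "l * l < m" and X: "hitting_set (wheel m) (arc_scramble m l) X"
  shows "l + 2 \<le> card X"
proof -
  have fin: "finite X"
    using X finite_subset unfolding hitting_set_def verts_wheel by blast
  have hub: "0 \<in> X"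
    using X by (auto simp: hitting_set_def arc_scramble_def)
  have hit: "X \<inter> arc m t l \<noteq> {}" for t
    using X by (auto simp: hitting_set_def arc_scramble_def)
  define start where "start = (\<lambda>(x, i). (x + (m - 1) * (i + 1)) mod m)"
  have "t \<in> start ` ((X - {0}) \<times> {..<l})" if "t < m" for t
  proof -
    from hit obtain i where i: "i < l" "rim m (t + i) \<in> X"
      by (auto simp: arc_def)
    \<comment> \<open>Adding \<open>(m - 1) * (i + 1)\<close> is subtraction of \<open>i + 1\<close> modulo \<open>m\<close>; the \<open>1\<close> undoes the shift
      between rim vertices and positions.\<close>
    have "start (rim m (t + i), i) = ((t + i) mod m + (1 + (m - 1) * (i + 1))) mod m"
      by (simp add: start_def rim_def)
    also have "\<dots> = (t + i + (1 + (m - 1) * (i + 1))) mod m"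
      by (rule mod_add_left_eq)
    also have "t + i + (1 + (m - 1) * (i + 1)) = t + m * (i + 1)"
      using assms(1) by (cases m) (auto simp: algebra_simps)
    also have "(t + m * (i + 1)) mod m = t"
      using that by (simp only: mod_mult_self2 mod_less)
    finally show ?thesis
      using i by (intro image_eqI[of _ _ "(rim m (t + i), i)"]) auto
  qed
  then have "{..<m} \<subseteq> start ` ((X - {0}) \<times> {..<l})" by blast
  then have "card {..<m} \<le> card ((X - {0}) \<times> {..<l})"
    using fin by (intro surj_card_le) auto
  then have "m \<le> card (X - {0}) * l" by (simp add: card_cartesian_product)
  with \<open>l * l < m\<close> have "l < card (X - {0})"
    by (metis less_le_trans mult_less_cancel2)
  then show ?thesis using fin hub by (simp add: card_Diff_singleton)
qed

lemma cut_edges_commute: "cut_edges G A B = cut_edges G B A"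
  by (auto simp: cut_edges_def insert_commute)

lemma finite_cut_edges_wheel:
  assumes "m \<ge> 3"
  shows "finite (cut_edges (wheel m) A B)"
proof -
  have "edges (wheel m) \<subseteq> Pow (verts (wheel m))" "finite (verts (wheel m))"
    using simple_graph_wheel[OF assms] by (auto simp: simple_graph_def)
  then have "finite (edges (wheel m))" by (meson finite_Pow_iff finite_subset)
  then show ?thesis by (simp add: cut_edges_def)
qed

text \<open>
  The set \<open>B\<close> is the side of a cut that avoids the hub.  As one walks around the rim, \<open>B\<close> is left
  and entered at least once each, and these are different edges because \<open>m \<ge> 3\<close>.
\<close>

lemma card_cut_edges_rim_ge:
  assumes m: "m \<ge> 3" and AB: "A \<union> B = verts (wheel m)" "A \<inter> B = {}"
    and hub: "0 \<in> A" and B: "B \<noteq> {}" "B \<noteq> {1..m}"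
  shows "card B + 2 \<le> card (cut_edges (wheel m) A B)"
proof -
  have sub: "B \<subseteq> {1..m}"
  proof
    fix x assume "x \<in> B"
    with AB hub have "x \<in> {0..m}" "x \<noteq> 0" by (auto simp: verts_wheel)
    then show "x \<in> {1..m}" by auto
  qed
  then have finB: "finite B" by (rule finite_subset) simp
  obtain x y where xy: "x \<in> {1..m}" "x \<in> B" "y \<in> {1..m}" "y \<notin> B"
    using sub B by blast
  obtain i where i: "rim m i \<in> B" "rim m (Suc i) \<notin> B"
    using rim_property_lost[of m x "\<lambda>v. v \<in> B" y] xy m by auto
  obtain j where j: "rim m j \<notin> B" "rim m (Suc j) \<in> B"
    using rim_property_lost[of m y "\<lambda>v. v \<notin> B" x] xy m by auto
  have inA: "rim m n \<in> A" if "rim m n \<notin> B" for n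
    using that AB rim_in[of m n] m by (auto simp: verts_wheel)
  let ?spokes = "(\<lambda>b. {0, b}) ` B"
  let ?out = "{rim m i, rim m (Suc i)}" and ?into = "{rim m j, rim m (Suc j)}"
  have "{0, b} \<in> cut_edges (wheel m) A B" if "b \<in> B" for b
  proof -
    have "b \<in> {1..m}" using that sub by blast
    then obtain n where "b = rim m n" by (rule rim_cases)
    then show ?thesis
      using that hub m by (auto simp: cut_edges_def edges_wheel)
  qed
  moreover have "?into \<in> cut_edges (wheel m) A B"
    using j inA[OF j(1)] m by (auto simp: cut_edges_def edges_wheel)
  moreover have "?out \<in> cut_edges (wheel m) B A"
    using i inA[OF i(2)] m by (auto simp: cut_edges_def edges_wheel)
  ultimately have cut: "insert ?out (insert ?into ?spokes) \<subseteq> cut_edges (wheel m) A B"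
    unfolding cut_edges_commute[of _ B A] by blast
  have "?out \<noteq> ?into"
  proof
    assume "?out = ?into"
    with i j have eq: "rim m i = rim m (Suc j)" "rim m (Suc i) = rim m j"
      by (auto simp: doubleton_eq_iff)
    then have "rim m (Suc (Suc i)) = rim m i"
      by (simp add: rim_Suc_eq_iff)
    then show False
      using m by (auto simp: rim_def mod_Suc split: if_splits)
  qed
  moreover have "?out \<notin> ?spokes" "?into \<notin> ?spokes"
    by (auto simp: doubleton_eq_iff)
  moreover have "card ?spokes = card B"
    by (rule card_image) (auto simp: inj_on_def doubleton_eq_iff)
  ultimately have "card (insert ?out (insert ?into ?spokes)) = card B + 2"
    using finB by simp
  then show ?thesis using card_mono[OF finite_cut_edges_wheel[OF m] cut] by simp
qed

lemma egg_cut_arc_scramble: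
  assumes m: "m \<ge> 3" and l: "l > 0" "l + 2 \<le> m"
    and C: "egg_cut (wheel m) (arc_scramble m l) C"
  shows "l + 2 \<le> card C"
proof -
  have bound: "l + 2 \<le> card (cut_edges (wheel m) A B)"
    if AB: "A \<union> B = verts (wheel m)" "A \<inter> B = {}" and hub: "0 \<in> A"
      and egg: "\<exists>H\<in>arc_scramble m l. verts H \<subseteq> B" for A B
  proof -
    from egg AB(2) hub obtain t where t: "arc m t l \<subseteq> B"
      by (auto simp: arc_scramble_def)
    have "finite B"
      using AB(1) by (metis finite_Un finite_atLeastAtMost verts_wheel)
    then have lB: "l \<le> card B"
      using card_mono[OF _ t] card_arc[of l m t] l by simp
    show ?thesis
    proof (cases "B = {1..m}")
      case True
      \<comment> \<open>Every edge of this cut is a spoke, and \<open>l + 2 \<le> m\<close> is exactly what is needed.\<close>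
      have "(\<lambda>b. {0, b}) ` {1..m} \<subseteq> cut_edges (wheel m) A B"
      proof
        fix e assume "e \<in> (\<lambda>b. {0, b}) ` {1..m}"
        then obtain b where b: "e = {0, b}" "b \<in> {1..m}" by blast
        from b(2) obtain n where "b = rim m n" by (rule rim_cases)
        then have "e \<in> edges (wheel m)" using b m by (simp add: edges_wheel)
        then show "e \<in> cut_edges (wheel m) A B"
          using b True hub unfolding cut_edges_def by blast
      qed
      moreover have "card ((\<lambda>b. {0, b}) ` {1..m}) = m"
        by (subst card_image) (auto simp: inj_on_def doubleton_eq_iff)
      ultimately show ?thesis
        using l card_mono[OF finite_cut_edges_wheel[OF m]] by (metis le_trans)
    next
      case False
      moreover have "B \<noteq> {}" using lB l by auto
      ultimately show ?thesis
        using card_cut_edges_rim_ge[OF m AB hub] lB by simp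
    qed
  qed
  from C obtain A B where AB: "A \<union> B = verts (wheel m)" "A \<inter> B = {}"
    "\<exists>H\<in>arc_scramble m l. verts H \<subseteq> A" "\<exists>H\<in>arc_scramble m l. verts H \<subseteq> B"
    "C = cut_edges (wheel m) A B"
    by (auto simp: egg_cut_def)
  have "0 \<in> A \<or> 0 \<in> B" using AB(1) by (auto simp: verts_wheel)
  then show ?thesis
  proof
    assume "0 \<in> A"
    then show ?thesis using bound[of A B] AB by simp
  next
    assume "0 \<in> B"
    then show ?thesis
      using bound[of B A] AB by (simp add: Un_commute Int_commute cut_edges_commute)
  qed
qed

lemma scramble_order_arc_scramble:
  assumes "m \<ge> 3" "l > 0" "l + 2 \<le> m" "l * l < m"
  shows "enat (l + 2) \<le> scramble_order (wheel m) (arc_scramble m l)"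
  unfolding scramble_order_def hitting_size_def egg_cut_size_def
  using assms hitting_set_arc_scramble[of m l] egg_cut_arc_scramble[of m l]
  by (intro min.boundedI Inf_greatest) auto

section \<open>Bounding an arbitrary scramble\<close>

lemma connected_subset_closed:
  assumes "connected_graph H" "simple_graph H" "x \<in> verts H" "x \<in> A"
    and closed: "\<And>u v. u \<in> A \<Longrightarrow> {u, v} \<in> edges H \<Longrightarrow> v \<in> A"
  shows "verts H \<subseteq> A"
proof
  fix y assume "y \<in> verts H"
  with assms have "(x, y) \<in> (adj H)\<^sup>*" by (auto simp: connected_graph_def)
  then show "y \<in> A"
    by (induction rule: rtrancl_induct) (use assms(4) closed in \<open>auto simp: adj_def\<close>)
qed

text \<open>
  If the egg is not the whole rim, it is entered somewhere on a walk around the rim; the arc that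
  starts there and extends until the egg is left again is closed under adjacency in the egg, so by
  connectedness it is the whole egg.
\<close>

lemma hub_free_egg_cases:
  assumes m: "m \<ge> 3" and H: "subgraph H (wheel m)" "verts H \<noteq> {}" "connected_graph H"
    and hub: "0 \<notin> verts H"
  obtains "verts H = {1..m}" | t l where "0 < l" "l < m" "verts H = arc m t l"
proof (cases "verts H = {1..m}")
  case False
  have sub: "verts H \<subseteq> {1..m}"
  proof
    fix x assume x: "x \<in> verts H"
    with H(1) have "x \<in> {0..m}" by (auto simp: subgraph_def verts_wheel)
    moreover have "x \<noteq> 0" using x hub by metis
    ultimately show "x \<in> {1..m}" by auto
  qed
  obtain x y where xy: "x \<in> {1..m}" "x \<in> verts H" "y \<in> {1..m}" "y \<notin> verts H"
    using sub H(2) False by blast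
  obtain j where j: "rim m j \<notin> verts H" "rim m (Suc j) \<in> verts H"
    using rim_property_lost[of m y "\<lambda>v. v \<notin> verts H" x] xy m by auto
  define t where "t = Suc j"
  define l where "l = (LEAST l. rim m (t + l) \<notin> verts H)"
  have "t + (m - 1) = j + m" using m by (simp add: t_def)
  then have "rim m (t + (m - 1)) = rim m j" by (simp add: rim_def)
  then have last: "rim m (t + (m - 1)) \<notin> verts H" using j by simp
  then have out: "rim m (t + l) \<notin> verts H" unfolding l_def by (rule LeastI)
  have "l \<le> m - 1" unfolding l_def using last by (rule Least_le)
  then have lm: "l < m" using m by simp
  have pos: "0 < l" using out j by (cases l) (auto simp: t_def)
  have inside: "rim m (t + i) \<in> verts H" if "i < l" for i
    using not_less_Least[of i] that unfolding l_def by blast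
  have "verts H \<subseteq> arc m t l"
  proof (rule connected_subset_closed[OF H(3)])
    show "simple_graph H" using H(1) by (simp add: subgraph_def)
    show "rim m t \<in> verts H" using j by (simp add: t_def)
    show "rim m t \<in> arc m t l" using pos by (force simp: arc_def)
  next
    fix u v assume u: "u \<in> arc m t l" and e: "{u, v} \<in> edges H"
    then obtain i where i: "i < l" "u = rim m (t + i)" by (auto simp: arc_def)
    have v: "v \<in> verts H" "{rim m (t + i), v} \<in> edges (wheel m)"
      using e i H(1) by (auto simp: subgraph_def simple_graph_def)
    from m v(2) show "v \<in> arc m t l"
    proof (cases rule: rim_neighbour_cases)
      case 1
      then show ?thesis using v hub by simp
    next
      case 2
      then have "Suc i \<noteq> l" using out v by auto
      then show ?thesis using 2 i arc_memI[of "Suc i" l] by simp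
    next
      case (3 n)
      show ?thesis
      proof (cases i)
        case 0
        then have "rim m n = rim m j" using 3 by (simp add: t_def rim_Suc_eq_iff)
        then show ?thesis using 3 v j by simp
      next
        case (Suc i')
        then have "v = rim m (t + i')" using 3 by (simp add: rim_Suc_eq_iff)
        then show ?thesis using Suc i by (auto simp: arc_def)
      qed
    qed
  qed
  moreover have "arc m t l \<subseteq> verts H" using inside by (auto simp: arc_def)
  ultimately show thesis using that(2) pos lm by blast
qed (use that in blast)

lemma card_cut_edges_arc_le:
  assumes m: "m \<ge> 3" and l: "l \<le> m"
  shows "card (cut_edges (wheel m) (verts (wheel m) - arc m t l) (arc m t l)) \<le> l + 2"
proof -
  \<comment> \<open>The index \<open>t + (m - 1)\<close> names the vertex before \<open>t\<close> without truncated subtraction.\<close>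
  let ?ends = "{{rim m (t + (l - 1)), rim m (t + l)}, {rim m (t + (m - 1)), rim m t}}"
  let ?spokes = "(\<lambda>v. {0, v}) ` arc m t l"
  have "cut_edges (wheel m) (verts (wheel m) - arc m t l) (arc m t l) \<subseteq> ?spokes \<union> ?ends"
  proof
    fix e assume "e \<in> cut_edges (wheel m) (verts (wheel m) - arc m t l) (arc m t l)"
    then obtain u v where "e \<in> edges (wheel m)" "v \<in> verts (wheel m) - arc m t l"
      and u: "u \<in> arc m t l" and "e = {v, u}"
      unfolding cut_edges_def by blast
    then have e: "e = {u, v}" "e \<in> edges (wheel m)" and "v \<notin> arc m t l"
      by (simp_all add: insert_commute)
    from u obtain i where i: "i < l" "u = rim m (t + i)" by (auto simp: arc_def)
    have "{rim m (t + i), v} \<in> edges (wheel m)" using e i by simp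
    with m show "e \<in> ?spokes \<union> ?ends"
    proof (cases rule: rim_neighbour_cases)
      case 1
      then show ?thesis using e u by (auto simp: insert_commute)
    next
      case 2
      then have "\<not> Suc i < l" using \<open>v \<notin> arc m t l\<close> arc_memI[of "Suc i" l] by auto
      then have "i = l - 1" "t + l = Suc (t + i)" using i by auto
      then show ?thesis using e i 2 by simp
    next
      case (3 n)
      have "i = 0"
      proof (rule ccontr)
        assume "i \<noteq> 0"
        then obtain i' where "i = Suc i'" by (cases i) auto
        then have "v = rim m (t + i')" "i' < l" using 3 i by (auto simp: rim_Suc_eq_iff)
        then show False using \<open>v \<notin> arc m t l\<close> by (auto simp: arc_def)
      qed
      have "rim m (Suc (t + (m - 1))) = rim m t"
        using m by (simp add: rim_def)
      with 3 \<open>i = 0\<close> have "rim m (t + (m - 1)) = rim m n"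
        by (metis add_0_right rim_Suc_eq_iff)
      then show ?thesis using e i 3 \<open>i = 0\<close> by (auto simp: insert_commute)
    qed
  qed
  then have "card (cut_edges (wheel m) (verts (wheel m) - arc m t l) (arc m t l))
      \<le> card (?spokes \<union> ?ends)"
    by (intro card_mono) (auto simp: finite_arc)
  also have "\<dots> \<le> card ?spokes + card ?ends" by (rule card_Un_le)
  also have "card ?spokes \<le> l"
    using card_image_le[OF finite_arc] card_arc[OF l] by metis
  also have "card ?ends \<le> 2" by (simp add: card_insert_if)
  finally show ?thesis by simp
qed

text \<open>
  Of \<open>s\<close> consecutive positions one is a multiple of \<open>s\<close>.  Let the arc start at a position below
  \<open>m\<close>.  If the first multiple on it is \<open>m\<close> or more, the arc contains position \<open>m\<close>, which is
  position \<open>0\<close> again; otherwise \<open>m \<le> s * s\<close> ensures that the multiple is one of the listed \<open>s\<close>.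
\<close>

lemma arc_meets_multiples:
  assumes "0 < s" "s \<le> l" "m \<le> s * s" "0 < m"
  shows "arc m t l \<inter> (\<lambda>j. rim m (j * s)) ` {..<s} \<noteq> {}"
proof -
  define r where "r = t mod m"
  have r: "r < m" using assms by (simp add: r_def)
  have arc: "rim m (r + i) \<in> arc m t l" if "i < l" for i
    using that unfolding r_def rim_add_mod by (auto simp: arc_def)
  define q where "q = (r + (s - 1)) div s"
  have q: "r \<le> q * s" "q * s < r + s"
  proof -
    have *: "q * s + (r + (s - 1)) mod s = r + (s - 1)"
      by (simp add: q_def)
    have "(r + (s - 1)) mod s < s" using assms by simp
    with * show "r \<le> q * s" "q * s < r + s" using assms(1) by linarith+
  qed
  show ?thesis
  proof (cases "q * s < m")
    case True
    then have "q * s < s * s" using assms(3) by linarith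
    then have "q < s" by (rule mult_less_cancel2[THEN iffD1, THEN conjunct2])
    moreover have "rim m (q * s) \<in> arc m t l"
      using arc[of "q * s - r"] q assms by simp
    ultimately show ?thesis by blast
  next
    case False
    have "rim m (0 * s) = rim m (r + (m - r))" using r by (simp add: rim_def)
    moreover have "rim m (r + (m - r)) \<in> arc m t l"
      using arc[of "m - r"] q False r assms by simp
    ultimately show ?thesis using assms(1) by (metis IntI empty_iff imageI lessThan_iff)
  qed
qed

lemma scramble_order_le:
  assumes m: "m \<ge> 3" and ml: "m \<le> (l + 1) * (l + 1)" and S: "scramble (wheel m) S"
  shows "scramble_order (wheel m) S \<le> enat (l + 2)"
proof -
  have hit: "scramble_order (wheel m) S \<le> enat (l + 2)"
    if "hitting_set (wheel m) S X" "card X \<le> l + 2" for X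
  proof -
    have "hitting_size (wheel m) S \<le> enat (card X)"
      unfolding hitting_size_def using that by (intro Inf_lower) blast
    also have "\<dots> \<le> enat (l + 2)" using that by simp
    finally show ?thesis by (simp add: scramble_order_def min.coboundedI1)
  qed
  show ?thesis
  proof (cases "\<exists>H\<in>S. \<exists>t n. 0 < n \<and> n < m \<and> n \<le> l \<and> verts H = arc m t n")
    case True
    then obtain H t n where H: "H \<in> S" "0 < n" "n < m" "n \<le> l" "verts H = arc m t n" by blast
    show ?thesis
    proof (cases "\<exists>H'\<in>S. verts H' \<inter> arc m t n = {}")
      case True
      then obtain H' where H': "H' \<in> S" "verts H' \<inter> arc m t n = {}" by blast
      let ?A = "verts (wheel m) - arc m t n"
      have sub: "arc m t n \<subseteq> verts (wheel m)"
        using arc_subset_rim[of m t n] m by (auto simp: verts_wheel)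
      have "verts H' \<subseteq> ?A"
        using H' S by (auto simp: scramble_def subgraph_def)
      then have "egg_cut (wheel m) S (cut_edges (wheel m) ?A (arc m t n))"
        unfolding egg_cut_def using sub H H' by (intro exI[of _ ?A] exI[of _ "arc m t n"]) auto
      then have "egg_cut_size (wheel m) S \<le> enat (card (cut_edges (wheel m) ?A (arc m t n)))"
        unfolding egg_cut_size_def by (intro Inf_lower) blast
      also have "\<dots> \<le> enat (l + 2)"
        using card_cut_edges_arc_le[OF m, of n t] H by simp
      finally show ?thesis by (simp add: scramble_order_def min.coboundedI2)
    next
      case False
      then have "hitting_set (wheel m) S (arc m t n)"
        using H S by (force simp: hitting_set_def scramble_def subgraph_def)
      then show ?thesis using hit[of "arc m t n"] card_arc[of n m t] H by simp
    qed
  next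
    case False
    let ?M = "(\<lambda>j. rim m (j * (l + 1))) ` {..<l + 1}"
    have "hitting_set (wheel m) S (insert 0 ?M)"
      unfolding hitting_set_def
    proof (intro conjI ballI)
      show "insert 0 ?M \<subseteq> verts (wheel m)"
        using rim_in[of m] m by (fastforce simp: verts_wheel)
    next
      fix H assume H: "H \<in> S"
      show "insert 0 ?M \<inter> verts H \<noteq> {}"
      proof (cases "0 \<in> verts H")
        case hub: False
        have "subgraph H (wheel m)" "verts H \<noteq> {}" "connected_graph H"
          using H S by (auto simp: scramble_def)
        from m this hub have "verts H \<inter> ?M \<noteq> {}"
        proof (cases rule: hub_free_egg_cases)
          case 1
          then have "rim m (0 * (l + 1)) \<in> verts H" using rim_in[of m] m by simp
          moreover have "rim m (0 * (l + 1)) \<in> ?M" by (rule imageI) simp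
          ultimately show ?thesis by (metis IntI empty_iff)
        next
          case (2 t n)
          then have "l + 1 \<le> n" using False H by (metis Suc_eq_plus1 not_less_eq_eq)
          then show ?thesis
            using 2 arc_meets_multiples[of "l + 1" n m t] ml m by simp
        qed
        then show ?thesis by blast
      qed blast
    qed
    moreover have "card (insert 0 ?M) \<le> l + 2"
    proof -
      have "card (insert 0 ?M) \<le> Suc (card ?M)" by (simp add: card_insert_if)
      also have "card ?M \<le> l + 1" using card_image_le[of "{..<l + 1}"] by simp
      finally show ?thesis by simp
    qed
    ultimately show ?thesis by (rule hit)
  qed
qed

section \<open>The scramble number of the wheel\<close>

lemma scramble_number_wheel:
  assumes m: "m \<ge> 3" and ml: "l * l < m" "m \<le> (l + 1) * (l + 1)"
  shows "scramble_number (wheel m) = enat (l + 2)"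
  unfolding scramble_number_def
proof (rule Max_eqI)
  show "finite {scramble_order (wheel m) S | S. scramble (wheel m) S}"
    using finite_scrambles[OF simple_graph_wheel[OF m]] by simp
next
  fix n assume "n \<in> {scramble_order (wheel m) S | S. scramble (wheel m) S}"
  then show "n \<le> enat (l + 2)" using scramble_order_le[OF m ml(2)] by blast
next
  have l: "l > 0" using m ml by (cases l) auto
  have "l + 2 \<le> m"
  proof (cases "l = 1")
    case False
    then have "2 * l \<le> l * l" using l by simp
    then show ?thesis using ml False l by linarith
  qed (use m in simp)
  then have "scramble_order (wheel m) (arc_scramble m l) = enat (l + 2)"
    using scramble_order_arc_scramble scramble_order_le[OF m ml(2)] scramble_arc_scramble m l ml
    by (intro antisym) auto
  then show "enat (l + 2) \<in> {scramble_order (wheel m) S | S. scramble (wheel m) S}"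
    using scramble_arc_scramble[OF m l] by force
qed

theorem lemma4p4:
  fixes m :: nat and k c :: int
  assumes "m \<ge> 3"
    and "k > 0" and "0 \<le> c" and "c \<le> 2 * k"
    and "int m = k\<^sup>2 + c"
  shows "scramble_number (wheel m) = enat (nat (\<lceil>sqrt (real m)\<rceil> + 1)) \<and>
    \<lceil>sqrt (real m)\<rceil> + 1 = (if c = 0 then \<lfloor>sqrt (real m)\<rfloor> + 1 else \<lfloor>sqrt (real m)\<rfloor> + 2)"
proof -
  define l where "l = (if c = 0 then nat k - 1 else nat k)"
  have intl: "int l = (if c = 0 then k - 1 else k)" using assms(2) by (simp add: l_def)
  have "int l * int l < int m"
    using assms intl by (auto simp: power2_eq_square algebra_simps)
  then have l1: "l * l < m" by (metis of_nat_less_iff of_nat_mult)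
  have "int m \<le> (int l + 1) * (int l + 1)"
    using assms intl by (auto simp: power2_eq_square algebra_simps)
  then have "int m \<le> int ((l + 1) * (l + 1))" by (simp add: algebra_simps)
  then have l2: "m \<le> (l + 1) * (l + 1)" by (simp only: of_nat_le_iff)
  have rm: "real m = (of_int k)\<^sup>2 + of_int c"
    using assms(5) by (metis of_int_add of_int_of_nat_eq of_int_power)
  have floor: "\<lfloor>sqrt (real m)\<rfloor> = k"
  proof (rule floor_unique)
    show "of_int k \<le> sqrt (real m)"
      using assms rm by (intro real_le_rsqrt) simp
    have "real m < (of_int k + 1)\<^sup>2"
      using assms(4) unfolding rm by (simp add: power2_eq_square algebra_simps)
    then show "sqrt (real m) < of_int k + 1"
      using assms(2) by (intro real_less_lsqrt) auto
  qed
  have ceil: "\<lceil>sqrt (real m)\<rceil> = int l + 1"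
  proof (rule ceiling_unique)
    have "real l * real l < real m" using l1 by (metis of_nat_less_iff of_nat_mult)
    then show "of_int (int l + 1) - 1 < sqrt (real m)"
      by (simp add: real_less_rsqrt power2_eq_square)
    have "real m \<le> (real l + 1) * (real l + 1)"
      using of_nat_mono[OF l2, where 'a = real] by (simp add: algebra_simps)
    then show "sqrt (real m) \<le> of_int (int l + 1)"
      by (intro real_le_lsqrt) (auto simp: power2_eq_square)
  qed
  have "scramble_number (wheel m) = enat (l + 2)"
    using scramble_number_wheel assms(1) l1 l2 by blast
  moreover have "nat (\<lceil>sqrt (real m)\<rceil> + 1) = l + 2" using ceil by simp
  ultimately show ?thesis using floor ceil intl by simp
qed

end
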